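(* Let $\mathsf{C}$ be a category of groups with operations, let $(A,B,\alpha)$ be a crossed module in $\mathsf{C}$ and let $d\in\operatorname{D}_{\alpha}(B,A)$ be a regular derivation. Put $\alpha_d=\sigma_d^{-1}\alpha\colon A\to B$. Then $(A,B,\alpha_d)$, equipped with the set of derived actions of $B$ on $A$ given by ${}^{b}a=\sigma_d(b)\cdot a$ and $b\,\tilde{*}\,a=\sigma_d(b)*a$ for $a\in A$, $b\in B$, $*\in\Omega_2'$, is a crossed module in $\mathsf{C}$.
   Context: Category of groups with operations. $\mathsf{C}$ is a category of groups with a set of operations $\Omega=\Omega_0\cup\Omega_1\cup\Omega_2$ ($\Omega_i$ the $i$-ary operations) and a set $E$ of identities including the group laws; i.e. objects are all algebras with operations $\Omega$ satisfying $E$. The group operations are written additively (not assumed commutative): $0\in\Omega_0$, $-\in\Omega_1$, $+\in\Omega_2$, and $\Omega_0=\{0\}$. Put $\Omega_2'=\Omega_2\setminus\{+\}$, $\Omega_1'=\Omega_1\setminus\{-\}$. If $*\in\Omega_2'$ then the operation $*^{\circ}$ defined by $a*^{\circ}b=b*a$ is also in $\Omega_2'$. $E$ includes $a*(b+c)=a*b+a*c$, $\omega(a+b)=\omega(a)+\omega(b)$ and $\omega(a)*b=\omega(a*b)$ for all $*\in\Omega_2'$, $\omega\in\Omega_1'$. Morphisms are group homomorphisms preserving all operations in $\Omega_1$ and $\Omega_2$. Derived actions. Given a split extension $0\to A\xrightarrow{\imath} E\xrightarrow{p} B\to 0$ in $\mathsf{C}$ ($p$ surjective, $\imath$ the kernel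 of $p$) with section $s\colon B\to E$ a morphism in $\mathsf{C}$, $ps=1_B$, one gets actions $b\cdot a=s(b)+a-s(b)$ and $b*a=s(b)*a$ (for each $*\in\Omega_2'$) of $B$ on $A$; sets of actions arising in this way are called sets of derived actions. One writes $a*b$ for $b*^{\circ}a$. Crossed modules. A crossed module $(A,B,\alpha)$ in $\mathsf{C}$ is a morphism $\alpha\colon A\to B$ in $\mathsf{C}$ with a set of derived actions of $B$ on $A$ such that for all $a,a_1\in A$, $b\in B$, $*\in\Omega_2'$: (CM1) $\alpha(b\cdot a)=b+\alpha(a)-b$; (CM2) $\alpha(a)\cdot a_1=a+a_1-a$; (CM3) $\alpha(b*a)=b*\alpha(a)$, $\alpha(a*b)=\alpha(a)*b$; (CM4) $\alpha(a)*a_1=a*a_1=a*\alpha(a_1)$. Derivations. A function $d\colon B\to A$ is a derivation of $(A,B,\alpha)$ if for all $b,b_1\in B$, $*\in\Omega_2'$, $\omega\in\Omega_1'$: $d(b+b_1)=d(b)+b\cdot d(b_1)$; $d(b*b_1)=d(b)*d(b_1)+d(b)*b_1+b*d(b_1)$; $d(\omega(b))=\omega(d(b))$. $\operatorname{Der}_{\alpha}(B,A)$ is the set of all derivations. For a derivation $d$, put $\theta_d(a)=d(\alpha(a))+a$ for $a\in A$ and $\sigma_d(b)=\alpha(d(b))+b$ for $b\in B$; these are endomorphisms of $A$ and $B$ in $\mathsf{C}$. Derivations are multiplied by $(d_1\circ d_2)(b)=d_1(\sigma_{d_2}(b))+d_2(b)$, with identity element the zero map. A derivation is regular if it has an inverse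 in $\operatorname{Der}_{\alpha}(B,A)$ with respect to $\circ$; for regular $d$, $\sigma_d$ is an automorphism of $B$ in $\mathsf{C}$. $\operatorname{D}_{\alpha}(B,A)$ denotes the group of regular derivations. *)

theory Defs
  imports "HOL-Algebra.Coset"
begin

text \<open>The group operation of an object is not assumed commutative, so its additive notation
  is rendered by the (multiplicative) group structure of HOL-Algebra: \<open>x + y\<close>, \<open>0\<close> and \<open>- x\<close>
  are \<open>x \<otimes>\<^bsub>G\<^esub> y\<close>, \<open>\<one>\<^bsub>G\<^esub>\<close> and \<open>inv\<^bsub>G\<^esub> x\<close>.\<close>

record ('a, 'f, 'g) gwo = "'a monoid" +
  op1 :: "'f \<Rightarrow> 'a \<Rightarrow> 'a"
  op2 :: "'g \<Rightarrow> 'a \<Rightarrow> 'a \<Rightarrow> 'a"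

datatype (ops1: 'f, ops2: 'g) trm =
    Var nat
  | Zero
  | Neg "('f, 'g) trm"
  | Plus "('f, 'g) trm" "('f, 'g) trm"
  | Op1 'f "('f, 'g) trm"
  | Op2 'g "('f, 'g) trm" "('f, 'g) trm"

primrec eval :: "('a, 'f, 'g) gwo \<Rightarrow> (nat \<Rightarrow> 'a) \<Rightarrow> ('f, 'g) trm \<Rightarrow> 'a" where
  "eval G v (Var n) = v n"
| "eval G v Zero = \<one>\<^bsub>G\<^esub>"
| "eval G v (Neg t) = inv\<^bsub>G\<^esub> (eval G v t)"
| "eval G v (Plus t u) = eval G v t \<otimes>\<^bsub>G\<^esub> eval G v u"
| "eval G v (Op1 w t) = op1 G w (eval G v t)"
| "eval G v (Op2 g t u) = op2 G g (eval G v t) (eval G v u)"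

text \<open>\<open>Om1\<close> and \<open>Om2\<close> are $\Omega_1'$ and $\Omega_2'$ (either may be empty), and \<open>opp\<close> is
  $* \mapsto *^{\circ}$.  The group laws belong to every category of groups with operations; they
  are imposed on the objects through \<^const>\<open>group\<close> and need not be repeated in \<open>idents\<close>.\<close>

record ('f, 'g) gwo_sig =
  Om1 :: "'f set"
  Om2 :: "'g set"
  opp :: "'g \<Rightarrow> 'g"
  idents :: "(('f, 'g) trm \<times> ('f, 'g) trm) set"

locale groups_with_operations =
  fixes C :: "('f, 'g) gwo_sig"
  assumes idents_wf:
      "(t, u) \<in> idents C \<Longrightarrow> ops1 t \<union> ops1 u \<subseteq> Om1 C \<and> ops2 t \<union> ops2 u \<subseteq> Om2 C"
    and opp_closed: "g \<in> Om2 C \<Longrightarrow> opp C g \<in> Om2 C"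
    and opp_ident: "g \<in> Om2 C \<Longrightarrow>
      (Op2 (opp C g) (Var 0) (Var 1), Op2 g (Var 1) (Var 0)) \<in> idents C"
    and op2_distrib: "g \<in> Om2 C \<Longrightarrow>
      (Op2 g (Var 0) (Plus (Var 1) (Var 2)),
       Plus (Op2 g (Var 0) (Var 1)) (Op2 g (Var 0) (Var 2))) \<in> idents C"
    and op1_additive: "w \<in> Om1 C \<Longrightarrow>
      (Op1 w (Plus (Var 0) (Var 1)), Plus (Op1 w (Var 0)) (Op1 w (Var 1))) \<in> idents C"
    and op1_op2: "w \<in> Om1 C \<Longrightarrow> g \<in> Om2 C \<Longrightarrow>
      (Op2 g (Op1 w (Var 0)) (Var 1), Op1 w (Op2 g (Var 0) (Var 1))) \<in> idents C"

definition gwo_object :: "('f, 'g) gwo_sig \<Rightarrow> ('a, 'f, 'g) gwo \<Rightarrow> bool" where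
  "gwo_object C G \<longleftrightarrow>
     group G \<and>
     (\<forall>w\<in>Om1 C. \<forall>x\<in>carrier G. op1 G w x \<in> carrier G) \<and>
     (\<forall>g\<in>Om2 C. \<forall>x\<in>carrier G. \<forall>y\<in>carrier G. op2 G g x y \<in> carrier G) \<and>
     (\<forall>(t, u)\<in>idents C. \<forall>v. range v \<subseteq> carrier G \<longrightarrow> eval G v t = eval G v u)"

definition gwo_morphism ::
  "('f, 'g) gwo_sig \<Rightarrow> ('a, 'f, 'g) gwo \<Rightarrow> ('b, 'f, 'g) gwo \<Rightarrow> ('a \<Rightarrow> 'b) \<Rightarrow> bool" where
  "gwo_morphism C G H h \<longleftrightarrow>
     h \<in> hom G H \<and>
     (\<forall>w\<in>Om1 C. \<forall>x\<in>carrier G. h (op1 G w x) = op1 H w (h x)) \<and>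
     (\<forall>g\<in>Om2 C. \<forall>x\<in>carrier G. \<forall>y\<in>carrier G. h (op2 G g x y) = op2 H g (h x) (h y))"

definition split_extension ::
  "('f, 'g) gwo_sig \<Rightarrow> ('a, 'f, 'g) gwo \<Rightarrow> ('e, 'f, 'g) gwo \<Rightarrow> ('b, 'f, 'g) gwo \<Rightarrow>
   ('a \<Rightarrow> 'e) \<Rightarrow> ('e \<Rightarrow> 'b) \<Rightarrow> ('b \<Rightarrow> 'e) \<Rightarrow> bool" where
  "split_extension C A E B i p s \<longleftrightarrow>
     gwo_object C A \<and> gwo_object C E \<and> gwo_object C B \<and>
     gwo_morphism C A E i \<and> gwo_morphism C E B p \<and> gwo_morphism C B E s \<and>
     inj_on i (carrier A) \<and> i ` carrier A = kernel E B p \<and>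
     p ` carrier E = carrier B \<and> (\<forall>b\<in>carrier B. p (s b) = b)"

text \<open>A set of actions of \<open>B\<close> on \<open>A\<close> consists of \<open>dot b a\<close> for $b \cdot a$ and \<open>star g b a\<close> for
  $b * a$, where \<open>g\<close> is the operation $*$ in $\Omega_2'$; accordingly $a * b = b *^{\circ} a$ is
  \<open>star (opp C g) b a\<close>.\<close>

definition induces_actions ::
  "('f, 'g) gwo_sig \<Rightarrow> ('a, 'f, 'g) gwo \<Rightarrow> ('e, 'f, 'g) gwo \<Rightarrow> ('b, 'f, 'g) gwo \<Rightarrow>
   ('a \<Rightarrow> 'e) \<Rightarrow> ('b \<Rightarrow> 'e) \<Rightarrow> ('b \<Rightarrow> 'a \<Rightarrow> 'a) \<Rightarrow> ('g \<Rightarrow> 'b \<Rightarrow> 'a \<Rightarrow> 'a) \<Rightarrow> bool" where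
  "induces_actions C A E B i s dot star \<longleftrightarrow>
     (\<forall>b\<in>carrier B. \<forall>a\<in>carrier A.
        dot b a \<in> carrier A \<and> i (dot b a) = s b \<otimes>\<^bsub>E\<^esub> i a \<otimes>\<^bsub>E\<^esub> inv\<^bsub>E\<^esub> (s b)) \<and>
     (\<forall>g\<in>Om2 C. \<forall>b\<in>carrier B. \<forall>a\<in>carrier A.
        star g b a \<in> carrier A \<and> i (star g b a) = op2 E g (s b) (i a))"

text \<open>HOL cannot quantify existentially over the type of the elements of \<open>E\<close>.  The type
  \<open>'a \<times> 'b\<close> loses no generality, by \<open>derived_actionsI\<close> below.\<close>

definition derived_actions ::
  "('f, 'g) gwo_sig \<Rightarrow> ('a, 'f, 'g) gwo \<Rightarrow> ('b, 'f, 'g) gwo \<Rightarrow>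
   ('b \<Rightarrow> 'a \<Rightarrow> 'a) \<Rightarrow> ('g \<Rightarrow> 'b \<Rightarrow> 'a \<Rightarrow> 'a) \<Rightarrow> bool" where
  "derived_actions C A B dot star \<longleftrightarrow>
     (\<exists>(E :: ('a \<times> 'b, 'f, 'g) gwo) i p s.
        split_extension C A E B i p s \<and> induces_actions C A E B i s dot star)"

definition crossed_module ::
  "('f, 'g) gwo_sig \<Rightarrow> ('a, 'f, 'g) gwo \<Rightarrow> ('b, 'f, 'g) gwo \<Rightarrow> ('a \<Rightarrow> 'b) \<Rightarrow>
   ('b \<Rightarrow> 'a \<Rightarrow> 'a) \<Rightarrow> ('g \<Rightarrow> 'b \<Rightarrow> 'a \<Rightarrow> 'a) \<Rightarrow> bool" where
  "crossed_module C A B \<alpha> dot star \<longleftrightarrow>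
     gwo_object C A \<and> gwo_object C B \<and> gwo_morphism C A B \<alpha> \<and>
     derived_actions C A B dot star \<and>
     (\<forall>b\<in>carrier B. \<forall>a\<in>carrier A. \<alpha> (dot b a) = b \<otimes>\<^bsub>B\<^esub> \<alpha> a \<otimes>\<^bsub>B\<^esub> inv\<^bsub>B\<^esub> b) \<and>
     (\<forall>a\<in>carrier A. \<forall>a1\<in>carrier A. dot (\<alpha> a) a1 = a \<otimes>\<^bsub>A\<^esub> a1 \<otimes>\<^bsub>A\<^esub> inv\<^bsub>A\<^esub> a) \<and>
     (\<forall>g\<in>Om2 C. \<forall>b\<in>carrier B. \<forall>a\<in>carrier A.
        \<alpha> (star g b a) = op2 B g b (\<alpha> a) \<and>
        \<alpha> (star (opp C g) b a) = op2 B g (\<alpha> a) b) \<and>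
     (\<forall>g\<in>Om2 C. \<forall>a\<in>carrier A. \<forall>a1\<in>carrier A.
        star g (\<alpha> a) a1 = op2 A g a a1 \<and>
        op2 A g a a1 = star (opp C g) (\<alpha> a1) a)"

text \<open>Derivations are functions on \<open>carrier B\<close>, i.e. extensional in HOL, so that equality of
  derivations is equality on \<open>carrier B\<close>.\<close>

definition derivations ::
  "('f, 'g) gwo_sig \<Rightarrow> ('a, 'f, 'g) gwo \<Rightarrow> ('b, 'f, 'g) gwo \<Rightarrow>
   ('b \<Rightarrow> 'a \<Rightarrow> 'a) \<Rightarrow> ('g \<Rightarrow> 'b \<Rightarrow> 'a \<Rightarrow> 'a) \<Rightarrow> ('b \<Rightarrow> 'a) set" where
  "derivations C A B dot star =
     {d \<in> carrier B \<rightarrow>\<^sub>E carrier A.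
        (\<forall>b\<in>carrier B. \<forall>b1\<in>carrier B. d (b \<otimes>\<^bsub>B\<^esub> b1) = d b \<otimes>\<^bsub>A\<^esub> dot b (d b1)) \<and>
        (\<forall>g\<in>Om2 C. \<forall>b\<in>carrier B. \<forall>b1\<in>carrier B.
           d (op2 B g b b1) =
             op2 A g (d b) (d b1) \<otimes>\<^bsub>A\<^esub> star (opp C g) b1 (d b) \<otimes>\<^bsub>A\<^esub> star g b (d b1)) \<and>
        (\<forall>w\<in>Om1 C. \<forall>b\<in>carrier B. d (op1 B w b) = op1 A w (d b))}"

definition sigma :: "('b, 'f, 'g) gwo \<Rightarrow> ('a \<Rightarrow> 'b) \<Rightarrow> ('b \<Rightarrow> 'a) \<Rightarrow> 'b \<Rightarrow> 'b" where
  "sigma B \<alpha> d b = \<alpha> (d b) \<otimes>\<^bsub>B\<^esub> b"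

definition Der ::
  "('f, 'g) gwo_sig \<Rightarrow> ('a, 'f, 'g) gwo \<Rightarrow> ('b, 'f, 'g) gwo \<Rightarrow> ('a \<Rightarrow> 'b) \<Rightarrow>
   ('b \<Rightarrow> 'a \<Rightarrow> 'a) \<Rightarrow> ('g \<Rightarrow> 'b \<Rightarrow> 'a \<Rightarrow> 'a) \<Rightarrow> ('b \<Rightarrow> 'a) monoid" where
  "Der C A B \<alpha> dot star =
     \<lparr>carrier = derivations C A B dot star,
      mult = (\<lambda>d1 d2. \<lambda>b\<in>carrier B. d1 (sigma B \<alpha> d2 b) \<otimes>\<^bsub>A\<^esub> d2 b),
      one = (\<lambda>b\<in>carrier B. \<one>\<^bsub>A\<^esub>)\<rparr>"

definition regular_derivations ::
  "('f, 'g) gwo_sig \<Rightarrow> ('a, 'f, 'g) gwo \<Rightarrow> ('b, 'f, 'g) gwo \<Rightarrow> ('a \<Rightarrow> 'b) \<Rightarrow>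
   ('b \<Rightarrow> 'a \<Rightarrow> 'a) \<Rightarrow> ('g \<Rightarrow> 'b \<Rightarrow> 'a \<Rightarrow> 'a) \<Rightarrow> ('b \<Rightarrow> 'a) monoid" where
  "regular_derivations C A B \<alpha> dot star = units_of (Der C A B \<alpha> dot star)"

subsection \<open>Any type may carry the split extension\<close>

definition transport :: "('a, 'f, 'g) gwo \<Rightarrow> ('a \<Rightarrow> 'b) \<Rightarrow> ('b, 'f, 'g) gwo" where
  "transport G h = (let k = inv_into (carrier G) h in
     \<lparr>carrier = h ` carrier G,
      mult = (\<lambda>x y. h (k x \<otimes>\<^bsub>G\<^esub> k y)), one = h \<one>\<^bsub>G\<^esub>,
      op1 = (\<lambda>w x. h (op1 G w (k x))), op2 = (\<lambda>g x y. h (op2 G g (k x) (k y)))\<rparr>)"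

lemma carrier_transport: "carrier (transport G h) = h ` carrier G"
  by (simp add: transport_def Let_def)

lemma eval_closed:
  assumes "gwo_object C G" "range v \<subseteq> carrier G" "ops1 t \<subseteq> Om1 C" "ops2 t \<subseteq> Om2 C"
  shows "eval G v t \<in> carrier G"
proof -
  interpret group G using assms(1) by (simp add: gwo_object_def)
  show ?thesis using assms by (induction t) (auto simp: gwo_object_def)
qed

lemma gwo_transport:
  assumes C: "groups_with_operations C" and G: "gwo_object C G" and h: "inj_on h (carrier G)"
  shows "gwo_object C (transport G h)" (is "gwo_object C ?H")
    and "gwo_morphism C G (transport G h) h"
    and "gwo_morphism C (transport G h) G (inv_into (carrier G) h)"
proof -
  let ?k = "inv_into (carrier G) h"
  interpret G: group G using G by (simp add: gwo_object_def)
  note cl = G[unfolded gwo_object_def]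
  have kh [simp]: "?k (h x) = x" if "x \<in> carrier G" for x using h that by simp
  have [simp]: "carrier ?H = h ` carrier G" "\<one>\<^bsub>?H\<^esub> = h \<one>\<^bsub>G\<^esub>"
    "x \<otimes>\<^bsub>?H\<^esub> y = h (?k x \<otimes>\<^bsub>G\<^esub> ?k y)" "op1 ?H w x = h (op1 G w (?k x))"
    "op2 ?H g x y = h (op2 G g (?k x) (?k y))" for x y w g
    by (simp_all add: transport_def Let_def)
  have H: "group ?H"
  proof (rule groupI)
    fix x assume "x \<in> carrier ?H"
    then obtain z where "z \<in> carrier G" "x = h z" by auto
    then show "\<exists>y\<in>carrier ?H. y \<otimes>\<^bsub>?H\<^esub> x = \<one>\<^bsub>?H\<^esub>"
      by (intro bexI[of _ "h (inv\<^bsub>G\<^esub> z)"]) auto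
  qed (auto simp: G.m_assoc)
  interpret H: group ?H by (rule H)
  have inv: "inv\<^bsub>?H\<^esub> (h x) = h (inv\<^bsub>G\<^esub> x)" if "x \<in> carrier G" for x
    using that by (intro H.inv_equality) auto
  have ev: "eval ?H v t = h (eval G (?k \<circ> v) t)"
    if v: "range v \<subseteq> carrier ?H" and "ops1 t \<subseteq> Om1 C" "ops2 t \<subseteq> Om2 C" for v t
  proof -
    have kv: "range (?k \<circ> v) \<subseteq> carrier G" using v by (auto simp: image_subset_iff inv_into_into)
    show ?thesis using that(2,3)
    proof (induction t)
      case (Var n) then show ?case using v by (auto simp: f_inv_into_f image_subset_iff)
    qed (use eval_closed[OF G kv] inv in auto)
  qed
  have "eval ?H v t = eval ?H v u" if tu: "(t, u) \<in> idents C" and v: "range v \<subseteq> carrier ?H" for t u v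
  proof -
    have "range (?k \<circ> v) \<subseteq> carrier G" using v by (auto simp: image_subset_iff inv_into_into)
    then have "eval G (?k \<circ> v) t = eval G (?k \<circ> v) u" using cl tu by blast
    then show ?thesis using ev[OF v] groups_with_operations.idents_wf[OF C tu] by simp
  qed
  then show "gwo_object C ?H" using H cl unfolding gwo_object_def by (auto simp: inv_into_into)
  show "gwo_morphism C G ?H h" using cl by (auto simp: gwo_morphism_def hom_def)
  show "gwo_morphism C ?H G ?k" using cl by (auto simp: gwo_morphism_def hom_def)
qed

lemma gwo_morphism_comp:
  "gwo_morphism C G H h \<Longrightarrow> gwo_morphism C H K k \<Longrightarrow> gwo_morphism C G K (k \<circ> h)"
  by (auto simp: gwo_morphism_def hom_def Pi_iff)

lemma derived_actionsI:
  fixes A :: "('a, 'f, 'g) gwo" and B :: "('b, 'f, 'g) gwo" and E :: "('e, 'f, 'g) gwo"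
  assumes C: "groups_with_operations C"
    and ext: "split_extension C A E B i p s" and act: "induces_actions C A E B i s dot star"
  shows "derived_actions C A B dot star"
proof -
  note x = ext[unfolded split_extension_def]
  interpret E: group E using x by (simp add: gwo_object_def)
  interpret B: group B using x by (simp add: gwo_object_def)
  have mi: "gwo_morphism C A E i" and mp: "gwo_morphism C E B p" and ms: "gwo_morphism C B E s"
    using x by auto
  have [simp]: "i a \<in> carrier E" if "a \<in> carrier A" for a
    using mi that by (auto simp: gwo_morphism_def hom_def)
  have [simp]: "s b \<in> carrier E" if "b \<in> carrier B" for b
    using ms that by (auto simp: gwo_morphism_def hom_def)
  have hp: "p \<in> hom E B" using mp by (simp add: gwo_morphism_def)
  interpret p: group_hom E B p
    by (intro group_hom.intro group_hom_axioms.intro E.group_axioms B.group_axioms hp)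
  have ps: "p (s b) = b" if "b \<in> carrier B" for b using x that by blast
  define r where "r e = e \<otimes>\<^bsub>E\<^esub> inv\<^bsub>E\<^esub> (s (p e))" for e
  define h where "h e = (inv_into (carrier A) i (r e), p e)" for e
  have r: "r e \<in> i ` carrier A" if "e \<in> carrier E" for e
  proof -
    have "r e \<in> kernel E B p" using that by (simp add: r_def kernel_def ps)
    then show ?thesis using x by simp
  qed
  have inj: "inj_on h (carrier E)"
  proof (rule inj_onI)
    fix e e' assume e: "e \<in> carrier E" "e' \<in> carrier E" and "h e = h e'"
    then have "r e = r e'" and pe: "p e = p e'"
      using r by (auto simp: h_def dest: inv_into_injective)
    then show "e = e'" using e by (simp add: r_def)
  qed
  let ?E = "transport E h" and ?k = "inv_into (carrier E) h"
  have E: "gwo_object C E" using x by simp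
  note t = gwo_transport[OF C E inj]
  interpret E': group ?E using t(1) by (simp add: gwo_object_def)
  have hh: "h \<in> hom E ?E" using t(2) by (simp add: gwo_morphism_def)
  interpret h: group_hom E ?E h
    by (intro group_hom.intro group_hom_axioms.intro E.group_axioms E'.group_axioms hh)
  have cE: "carrier ?E = h ` carrier E" by (rule carrier_transport)
  have kh: "?k (h e) = e" if "e \<in> carrier E" for e using inj that by simp
  have ker: "kernel ?E B (p \<circ> ?k) = h ` kernel E B p" by (auto simp: kernel_def cE kh)
  have "split_extension C A ?E B (h \<circ> i) (p \<circ> ?k) (h \<circ> s)"
    unfolding split_extension_def
  proof (intro conjI)
    show "inj_on (h \<circ> i) (carrier A)"
      using x inj by (auto intro!: comp_inj_on elim: inj_on_subset)
    show "(h \<circ> i) ` carrier A = kernel ?E B (p \<circ> ?k)"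
      using x ker by (metis image_comp)
    show "(p \<circ> ?k) ` carrier ?E = carrier B"
      using x by (auto simp: cE kh image_image)
    show "\<forall>b\<in>carrier B. (p \<circ> ?k) ((h \<circ> s) b) = b" by (simp add: kh ps)
  qed (use x t in \<open>auto intro: gwo_morphism_comp\<close>)
  moreover have "induces_actions C A ?E B (h \<circ> i) (h \<circ> s) dot star"
    using act t(2) by (auto simp: induces_actions_def gwo_morphism_def)
  ultimately show ?thesis unfolding derived_actions_def by blast
qed

end

theory Submission
  imports Defs
begin

text \<open>Two facts combine.  The notion of a crossed module is symmetric under automorphisms of
  the base: if \<open>\<phi>\<close> is any automorphism of \<open>B\<close> in the category, then \<open>\<phi>\<^sup>-\<^sup>1 \<alpha>\<close> together with
  the actions restricted along \<open>\<phi>\<close> is again a crossed module (\<open>crossed_module_twist\<close>).  The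
  boundary and the actions are changed in opposite directions, so \<open>\<phi>\<close> cancels in (CM2) and
  (CM4), while (CM1) and (CM3) are the old identities with \<open>\<phi>\<^sup>-\<^sup>1\<close> applied; the actions stay
  derived because a split extension \<open>(i, p, s)\<close> becomes the split extension
  \<open>(i, \<phi>\<^sup>-\<^sup>1 p, s \<phi>)\<close> with the same middle object.

  It remains that \<open>\<sigma>\<^sub>d\<close> is such an automorphism.  It is an endomorphism for every derivation
  \<open>d\<close> (\<open>sigma_morphism\<close>); the only subtle point is that the expansion of
  \<open>(\<alpha>(d b) + b) * (\<alpha>(d b\<^sub>1) + b\<^sub>1)\<close> and the derivation rule for \<open>*\<close> list the two mixed
  products in different orders, which agree because such products commute in any object
  (\<open>op2_mixed_commute\<close>).  And \<open>d \<mapsto> \<sigma>\<^sub>d\<close> turns \<open>\<circ>\<close> into composition and the zero map into the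
  identity, so an inverse of \<open>d\<close> gives an inverse of \<open>\<sigma>\<^sub>d\<close> (\<open>sigma_bij\<close>).\<close>

lemma gwo_identity:
  assumes "gwo_object C G" "(t, u) \<in> idents C" "x \<in> carrier G" "y \<in> carrier G" "z \<in> carrier G"
  shows "eval G (\<lambda>n. if n = 0 then x else if n = 1 then y else z) t
       = eval G (\<lambda>n. if n = 0 then x else if n = 1 then y else z) u"
proof -
  have "range (\<lambda>n::nat. if n = 0 then x else if n = 1 then y else z) \<subseteq> carrier G"
    using assms by auto
  then show ?thesis using assms(1,2) unfolding gwo_object_def by blast
qed

context groups_with_operations
begin

lemma op2_right_distrib:
  assumes G: "gwo_object C G" and g: "g \<in> Om2 C"
    and x: "x \<in> carrier G" and y: "y \<in> carrier G" and z: "z \<in> carrier G"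
  shows "op2 G g x (y \<otimes>\<^bsub>G\<^esub> z) = op2 G g x y \<otimes>\<^bsub>G\<^esub> op2 G g x z"
  using gwo_identity[OF G op2_distrib[OF g] x y z] by simp

lemma op2_opp:
  assumes G: "gwo_object C G" and g: "g \<in> Om2 C" and x: "x \<in> carrier G" and y: "y \<in> carrier G"
  shows "op2 G (opp C g) x y = op2 G g y x"
  using gwo_identity[OF G opp_ident[OF g] x y y] by simp

lemma op2_left_distrib:
  assumes G: "gwo_object C G" and g: "g \<in> Om2 C"
    and x: "x \<in> carrier G" and y: "y \<in> carrier G" and z: "z \<in> carrier G"
  shows "op2 G g (x \<otimes>\<^bsub>G\<^esub> y) z = op2 G g x z \<otimes>\<^bsub>G\<^esub> op2 G g y z"
proof -
  interpret group G using G by (simp add: gwo_object_def)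
  show ?thesis
    using op2_right_distrib[OF G opp_closed[OF g] z x y] x y z by (simp add: op2_opp[OF G g])
qed

lemma op1_add:
  assumes G: "gwo_object C G" and w: "w \<in> Om1 C" and x: "x \<in> carrier G" and y: "y \<in> carrier G"
  shows "op1 G w (x \<otimes>\<^bsub>G\<^esub> y) = op1 G w x \<otimes>\<^bsub>G\<^esub> op1 G w y"
  using gwo_identity[OF G op1_additive[OF w] x y y] by simp

text \<open>Expand \<open>(x + y) * (z + w)\<close> by the two distributive laws in either order and cancel the
  outer terms \<open>x * z\<close> and \<open>y * w\<close>.\<close>

lemma op2_mixed_commute:
  assumes G: "gwo_object C G" and g: "g \<in> Om2 C"
    and x: "x \<in> carrier G" and y: "y \<in> carrier G" and z: "z \<in> carrier G" and w: "w \<in> carrier G"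
  shows "op2 G g x w \<otimes>\<^bsub>G\<^esub> op2 G g y z = op2 G g y z \<otimes>\<^bsub>G\<^esub> op2 G g x w"
proof -
  interpret group G using G by (simp add: gwo_object_def)
  have cl [simp]: "op2 G g u v \<in> carrier G" if "u \<in> carrier G" "v \<in> carrier G" for u v
    using G g that by (simp add: gwo_object_def)
  have "op2 G g (x \<otimes>\<^bsub>G\<^esub> y) (z \<otimes>\<^bsub>G\<^esub> w)
      = op2 G g x z \<otimes>\<^bsub>G\<^esub> (op2 G g y z \<otimes>\<^bsub>G\<^esub> op2 G g x w) \<otimes>\<^bsub>G\<^esub> op2 G g y w"
    using x y z w
    by (simp add: op2_right_distrib[OF G g] op2_left_distrib[OF G g] m_assoc)
  moreover have "op2 G g (x \<otimes>\<^bsub>G\<^esub> y) (z \<otimes>\<^bsub>G\<^esub> w)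
      = op2 G g x (z \<otimes>\<^bsub>G\<^esub> w) \<otimes>\<^bsub>G\<^esub> op2 G g y (z \<otimes>\<^bsub>G\<^esub> w)"
    using x y z w by (intro op2_left_distrib[OF G g]) auto
  then have "op2 G g (x \<otimes>\<^bsub>G\<^esub> y) (z \<otimes>\<^bsub>G\<^esub> w)
      = op2 G g x z \<otimes>\<^bsub>G\<^esub> (op2 G g x w \<otimes>\<^bsub>G\<^esub> op2 G g y z) \<otimes>\<^bsub>G\<^esub> op2 G g y w"
    using x y z w by (simp add: op2_right_distrib[OF G g] m_assoc)
  ultimately show ?thesis using x y z w by simp
qed

text \<open>Apply \<open>\<alpha>\<close> to the derivation rules.  (CM1) turns \<open>\<alpha>(b \<cdot> d c)\<close> into a conjugate, whose
  final \<open>- b\<close> cancels against the summand \<open>b\<close> of \<open>\<sigma>\<^sub>d(b + c)\<close>; (CM3) turns the mixed terms into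
  products in \<open>B\<close>, so that \<open>\<sigma>\<^sub>d(b * c)\<close> becomes the distributive expansion of
  \<open>\<sigma>\<^sub>d(b) * \<sigma>\<^sub>d(c)\<close>.\<close>

lemma sigma_morphism:
  assumes cm: "crossed_module C A B \<alpha> dot star" and d: "d \<in> derivations C A B dot star"
  shows "gwo_morphism C B B (sigma B \<alpha> d)"
proof -
  have A: "gwo_object C A" and B: "gwo_object C B" and \<alpha>: "gwo_morphism C A B \<alpha>"
    and act: "derived_actions C A B dot star"
    using cm by (auto simp: crossed_module_def)
  have cm1: "\<alpha> (dot b a) = b \<otimes>\<^bsub>B\<^esub> \<alpha> a \<otimes>\<^bsub>B\<^esub> inv\<^bsub>B\<^esub> b"
    if "b \<in> carrier B" "a \<in> carrier A" for a b
    using cm that by (auto simp: crossed_module_def)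
  have cm3: "\<alpha> (star g b a) = op2 B g b (\<alpha> a)" "\<alpha> (star (opp C g) b a) = op2 B g (\<alpha> a) b"
    if "g \<in> Om2 C" "b \<in> carrier B" "a \<in> carrier A" for a b g
    using cm that by (auto simp: crossed_module_def)
  have dot [simp]: "dot b a \<in> carrier A" if "b \<in> carrier B" "a \<in> carrier A" for a b
    using act that by (auto simp: derived_actions_def induces_actions_def)
  have star [simp]: "star g b a \<in> carrier A"
    if "g \<in> Om2 C" "b \<in> carrier B" "a \<in> carrier A" for a b g
    using act that by (auto simp: derived_actions_def induces_actions_def)
  interpret A: group A using A by (simp add: gwo_object_def)
  interpret B: group B using B by (simp add: gwo_object_def)
  have opA [simp]: "op2 A g x y \<in> carrier A"
    if "g \<in> Om2 C" "x \<in> carrier A" "y \<in> carrier A" for g x y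
    using A that by (auto simp: gwo_object_def)
  have opB [simp]: "op2 B g x y \<in> carrier B"
    if "g \<in> Om2 C" "x \<in> carrier B" "y \<in> carrier B" for g x y
    using B that by (auto simp: gwo_object_def)
  have \<alpha>c [simp]: "\<alpha> a \<in> carrier B" if "a \<in> carrier A" for a
    using \<alpha> that by (auto simp: gwo_morphism_def hom_def)
  have \<alpha>m: "\<alpha> (x \<otimes>\<^bsub>A\<^esub> y) = \<alpha> x \<otimes>\<^bsub>B\<^esub> \<alpha> y" if "x \<in> carrier A" "y \<in> carrier A" for x y
    using \<alpha> that by (auto simp: gwo_morphism_def hom_def)
  have dc [simp]: "d b \<in> carrier A" if "b \<in> carrier B" for b
    using d that by (auto simp: derivations_def)
  have "sigma B \<alpha> d (b \<otimes>\<^bsub>B\<^esub> c) = sigma B \<alpha> d b \<otimes>\<^bsub>B\<^esub> sigma B \<alpha> d c"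
    if b: "b \<in> carrier B" and c: "c \<in> carrier B" for b c
  proof -
    have "d (b \<otimes>\<^bsub>B\<^esub> c) = d b \<otimes>\<^bsub>A\<^esub> dot b (d c)" using d b c by (simp add: derivations_def)
    moreover have "inv\<^bsub>B\<^esub> b \<otimes>\<^bsub>B\<^esub> (b \<otimes>\<^bsub>B\<^esub> c) = c" using b c by (simp add: B.m_assoc[symmetric])
    ultimately show ?thesis using b c by (simp add: sigma_def \<alpha>m cm1 B.m_assoc)
  qed
  moreover have "sigma B \<alpha> d (op1 B w b) = op1 B w (sigma B \<alpha> d b)"
    if w: "w \<in> Om1 C" and b: "b \<in> carrier B" for w b
  proof -
    have "d (op1 B w b) = op1 A w (d b)" using d w b by (simp add: derivations_def)
    moreover have "\<alpha> (op1 A w (d b)) = op1 B w (\<alpha> (d b))"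
      using \<alpha> w b by (simp add: gwo_morphism_def)
    ultimately show ?thesis using w b by (simp add: sigma_def op1_add[OF B])
  qed
  moreover have "sigma B \<alpha> d (op2 B g b c) = op2 B g (sigma B \<alpha> d b) (sigma B \<alpha> d c)"
    if g: "g \<in> Om2 C" and b: "b \<in> carrier B" and c: "c \<in> carrier B" for g b c
  proof -
    have "d (op2 B g b c)
        = op2 A g (d b) (d c) \<otimes>\<^bsub>A\<^esub> star (opp C g) c (d b) \<otimes>\<^bsub>A\<^esub> star g b (d c)"
      using d g b c by (simp add: derivations_def)
    moreover have "\<alpha> (op2 A g (d b) (d c)) = op2 B g (\<alpha> (d b)) (\<alpha> (d c))"
      using \<alpha> g b c by (simp add: gwo_morphism_def)
    ultimately have "sigma B \<alpha> d (op2 B g b c) =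
        op2 B g (\<alpha> (d b)) (\<alpha> (d c))
          \<otimes>\<^bsub>B\<^esub> (op2 B g (\<alpha> (d b)) c \<otimes>\<^bsub>B\<^esub> op2 B g b (\<alpha> (d c))) \<otimes>\<^bsub>B\<^esub> op2 B g b c"
      using g b c by (simp add: sigma_def \<alpha>m cm3(1) opp_closed op2_opp[OF B g] B.m_assoc)
    also have "\<dots> = op2 B g (\<alpha> (d b)) (\<alpha> (d c))
          \<otimes>\<^bsub>B\<^esub> (op2 B g b (\<alpha> (d c)) \<otimes>\<^bsub>B\<^esub> op2 B g (\<alpha> (d b)) c) \<otimes>\<^bsub>B\<^esub> op2 B g b c"
      using g b c by (simp add: op2_mixed_commute[OF B g, of "\<alpha> (d b)" b "\<alpha> (d c)" c])
    also have "\<dots> = op2 B g (sigma B \<alpha> d b) (sigma B \<alpha> d c)"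
      using g b c
      by (simp add: sigma_def op2_right_distrib[OF B g] op2_left_distrib[OF B g] B.m_assoc)
    finally show ?thesis .
  qed
  moreover have "sigma B \<alpha> d b \<in> carrier B" if "b \<in> carrier B" for b
    using that by (simp add: sigma_def)
  ultimately show ?thesis by (auto simp: gwo_morphism_def hom_def)
qed

end

text \<open>If \<open>e\<close> is inverse to \<open>d\<close> for \<open>\<circ>\<close>, then \<open>\<sigma>\<^sub>e\<close> is inverse to \<open>\<sigma>\<^sub>d\<close>: applying \<open>\<alpha>\<close> to
  \<open>(f \<circ> h)(b) = 0\<close> shows that \<open>\<sigma>\<^sub>f(\<sigma>\<^sub>h(b))\<close>, which is
  \<open>\<alpha>(f(\<sigma>\<^sub>h(b))) + \<alpha>(h(b)) + b\<close>, equals \<open>b\<close>.\<close>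

lemma sigma_bij:
  assumes cm: "crossed_module C A B \<alpha> dot star"
    and d: "d \<in> carrier (regular_derivations C A B \<alpha> dot star)"
  shows "bij_betw (sigma B \<alpha> d) (carrier B) (carrier B)"
proof -
  have A: "gwo_object C A" and B: "gwo_object C B" and \<alpha>: "\<alpha> \<in> hom A B"
    using cm by (auto simp: crossed_module_def gwo_morphism_def)
  interpret A: group A using A by (simp add: gwo_object_def)
  interpret B: group B using B by (simp add: gwo_object_def)
  interpret \<alpha>: group_hom A B \<alpha>
    by (intro group_hom.intro group_hom_axioms.intro A.group_axioms B.group_axioms \<alpha>)
  let ?D = "Der C A B \<alpha> dot star"
  obtain e where dd: "d \<in> derivations C A B dot star" and e: "e \<in> derivations C A B dot star"
    and ed: "e \<otimes>\<^bsub>?D\<^esub> d = \<one>\<^bsub>?D\<^esub>" and de: "d \<otimes>\<^bsub>?D\<^esub> e = \<one>\<^bsub>?D\<^esub>"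
    using d by (auto simp: regular_derivations_def units_of_def Units_def Der_def)
  have cl: "f b \<in> carrier A" "sigma B \<alpha> f b \<in> carrier B"
    if "f \<in> derivations C A B dot star" "b \<in> carrier B" for f b
    using that by (auto simp: derivations_def sigma_def PiE_iff)
  have inverse: "sigma B \<alpha> f (sigma B \<alpha> h b) = b"
    if f: "f \<in> derivations C A B dot star" and h: "h \<in> derivations C A B dot star"
      and fh: "f \<otimes>\<^bsub>?D\<^esub> h = \<one>\<^bsub>?D\<^esub>" and b: "b \<in> carrier B" for f h b
  proof -
    note c = cl(1)[OF h b] cl(2)[OF h b] cl(1)[OF f cl(2)[OF h b]]
    have "f (sigma B \<alpha> h b) \<otimes>\<^bsub>A\<^esub> h b = \<one>\<^bsub>A\<^esub>"
      using fun_cong[OF fh, of b] b by (simp add: Der_def)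
    then have "\<alpha> (f (sigma B \<alpha> h b)) \<otimes>\<^bsub>B\<^esub> \<alpha> (h b) = \<one>\<^bsub>B\<^esub>"
      using c by (metis \<alpha>.hom_mult \<alpha>.hom_one)
    moreover have "sigma B \<alpha> f (sigma B \<alpha> h b)
        = \<alpha> (f (sigma B \<alpha> h b)) \<otimes>\<^bsub>B\<^esub> \<alpha> (h b) \<otimes>\<^bsub>B\<^esub> b"
      using c b by (simp add: sigma_def[of B \<alpha> f] sigma_def[of B \<alpha> h b] B.m_assoc)
    ultimately show ?thesis using b by simp
  qed
  show ?thesis
    by (rule bij_betw_byWitness[where f' = "sigma B \<alpha> e"])
      (use inverse[OF e dd ed] inverse[OF dd e de] cl(2)[OF dd] cl(2)[OF e] in auto)
qed

lemma gwo_morphism_inv_into: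
  assumes G: "gwo_object C G" and f: "gwo_morphism C G H f"
    and bij: "bij_betw f (carrier G) (carrier H)"
  shows "gwo_morphism C H G (inv_into (carrier G) f)" (is "gwo_morphism C H G ?k")
proof -
  interpret group G using G by (simp add: gwo_object_def)
  have kc: "?k y \<in> carrier G" and fk: "f (?k y) = y" if "y \<in> carrier H" for y
    using bij that by (auto simp: bij_betw_def inv_into_into f_inv_into_f)
  have eq: "?k y = x" if "x \<in> carrier G" "f x = y" for x y
    using bij that by (auto simp: bij_betw_def)
  show ?thesis
    unfolding gwo_morphism_def hom_def
    using f G by (auto intro!: eq simp: kc fk gwo_morphism_def hom_def gwo_object_def)
qed

text \<open>Relabelling the quotient by an automorphism keeps the kernel of the projection, hence the
  inclusion \<open>i\<close> as well; the section has to be relabelled in the opposite direction to remain a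
  section.\<close>

lemma split_extension_twist:
  assumes ext: "split_extension C A E B i p s" and f: "gwo_morphism C B B f"
    and bij: "bij_betw f (carrier B) (carrier B)"
  shows "split_extension C A E B i (inv_into (carrier B) f \<circ> p) (s \<circ> f)"
proof -
  let ?k = "inv_into (carrier B) f"
  have B: "gwo_object C B" and p: "gwo_morphism C E B p"
    using ext by (auto simp: split_extension_def)
  interpret B: group B using B by (simp add: gwo_object_def)
  have k: "gwo_morphism C B B ?k" by (rule gwo_morphism_inv_into[OF B f bij])
  have kbij: "bij_betw ?k (carrier B) (carrier B)" by (rule bij_betw_inv_into[OF bij])
  have pc: "p x \<in> carrier B" if "x \<in> carrier E" for x
    using p that by (auto simp: gwo_morphism_def hom_def)
  have fc: "f b \<in> carrier B" and kf: "?k (f b) = b" if "b \<in> carrier B" for b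
    using bij that by (auto simp: bij_betw_def)
  have k1: "?k \<one>\<^bsub>B\<^esub> = \<one>\<^bsub>B\<^esub>"
    using k by (intro hom_one[OF _ B.group_axioms B.group_axioms]) (simp add: gwo_morphism_def)
  have "?k (p x) = \<one>\<^bsub>B\<^esub> \<longleftrightarrow> p x = \<one>\<^bsub>B\<^esub>" if "x \<in> carrier E" for x
    using kbij pc[OF that] k1 by (metis B.one_closed bij_betw_def inj_onD)
  then have "kernel E B (?k \<circ> p) = kernel E B p" by (auto simp: kernel_def)
  moreover have "(?k \<circ> p) ` carrier E = carrier B"
    using ext kbij by (metis bij_betw_def image_comp split_extension_def)
  ultimately show ?thesis
    using ext k f fc kf by (auto simp: split_extension_def intro: gwo_morphism_comp)
qed

text \<open>Only the section enters the induced actions, so the twisted extension induces the actions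
  restricted along \<open>f\<close>.  For the identities, (CM1) becomes
  \<open>f\<^sup>-\<^sup>1(f(b) + \<alpha>(a) - f(b)) = b + f\<^sup>-\<^sup>1(\<alpha>(a)) - b\<close>, and (CM3) is treated in the same way; in
  (CM2) and (CM4) the acting element is \<open>f(f\<^sup>-\<^sup>1(\<alpha>(a))) = \<alpha>(a)\<close>, as before.\<close>

lemma crossed_module_twist:
  fixes A :: "('a, 'f, 'g) gwo" and B :: "('b, 'f, 'g) gwo"
  assumes cm: "crossed_module C A B \<alpha> dot star" and f: "gwo_morphism C B B f"
    and bij: "bij_betw f (carrier B) (carrier B)"
  shows "crossed_module C A B (inv_into (carrier B) f \<circ> \<alpha>)
           (\<lambda>b a. dot (f b) a) (\<lambda>g b a. star g (f b) a)"
proof -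
  let ?k = "inv_into (carrier B) f"
  have A: "gwo_object C A" and B: "gwo_object C B" and \<alpha>: "gwo_morphism C A B \<alpha>"
    and act: "derived_actions C A B dot star"
    using cm by (auto simp: crossed_module_def)
  interpret B: group B using B by (simp add: gwo_object_def)
  have k: "gwo_morphism C B B ?k" by (rule gwo_morphism_inv_into[OF B f bij])
  interpret k: group_hom B B ?k
    using k by (intro group_hom.intro group_hom_axioms.intro B.group_axioms)
      (simp add: gwo_morphism_def)
  have fc [simp]: "f b \<in> carrier B" and kf [simp]: "?k (f b) = b" and fk [simp]: "f (?k b) = b"
    if "b \<in> carrier B" for b
    using bij that by (auto simp: bij_betw_def f_inv_into_f)
  have \<alpha>c [simp]: "\<alpha> a \<in> carrier B" if "a \<in> carrier A" for a
    using \<alpha> that by (auto simp: gwo_morphism_def hom_def)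
  have k2: "?k (op2 B g x y) = op2 B g (?k x) (?k y)"
    if "g \<in> Om2 C" "x \<in> carrier B" "y \<in> carrier B" for g x y
    using k that by (simp add: gwo_morphism_def)
  have "derived_actions C A B (\<lambda>b a. dot (f b) a) (\<lambda>g b a. star g (f b) a)"
  proof -
    obtain E :: "('a \<times> 'b, 'f, 'g) gwo" and i p s
      where ext: "split_extension C A E B i p s" and ind: "induces_actions C A E B i s dot star"
      using act by (auto simp: derived_actions_def)
    have "induces_actions C A E B i (s \<circ> f) (\<lambda>b a. dot (f b) a) (\<lambda>g b a. star g (f b) a)"
      using ind by (auto simp: induces_actions_def)
    then show ?thesis
      using split_extension_twist[OF ext f bij] unfolding derived_actions_def by blast
  qed
  moreover have "gwo_morphism C A B (?k \<circ> \<alpha>)" by (rule gwo_morphism_comp[OF \<alpha> k])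
  ultimately show ?thesis
    using cm A B by (auto simp: crossed_module_def k2)
qed

theorem proposition4p8:
  fixes C :: "('f, 'g) gwo_sig"
    and A :: "('a, 'f, 'g) gwo" and B :: "('b, 'f, 'g) gwo"
    and \<alpha> :: "'a \<Rightarrow> 'b"
    and dot :: "'b \<Rightarrow> 'a \<Rightarrow> 'a" and star :: "'g \<Rightarrow> 'b \<Rightarrow> 'a \<Rightarrow> 'a"
    and d :: "'b \<Rightarrow> 'a"
  assumes "groups_with_operations C"
    and "crossed_module C A B \<alpha> dot star"
    and "d \<in> carrier (regular_derivations C A B \<alpha> dot star)"
  shows "crossed_module C A B
           (inv_into (carrier B) (sigma B \<alpha> d) \<circ> \<alpha>)
           (\<lambda>b a. dot (sigma B \<alpha> d b) a)
           (\<lambda>g b a. star g (sigma B \<alpha> d b) a)"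
proof (rule crossed_module_twist[OF assms(2)])
  have "d \<in> derivations C A B dot star"
    using assms(3) by (simp add: regular_derivations_def units_of_def Units_def Der_def)
  then show "gwo_morphism C B B (sigma B \<alpha> d)"
    by (rule groups_with_operations.sigma_morphism[OF assms(1,2)])
  show "bij_betw (sigma B \<alpha> d) (carrier B) (carrier B)"
    by (rule sigma_bij[OF assms(2,3)])
qed

end
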